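(* Fix either version $B=X$ or $B=D$, and let $\mathcal I$ be an admissible order ideal in $\mathcal P$. Then the space $B[\mathcal P\setminus\mathcal I]=\bigcup_{\mathfrak f\in\mathcal P\setminus\mathcal I}B[\mathfrak f]$ is a strong deformation retract of $B[\mathbb I]\setminus B[\mathbb J]$.
   Context: $\mathfrak g$ is the Lie algebra of a compact Lie group with Euclidean inner product $Q$ satisfying $Q([X,Y],Z)=Q(X,[Y,Z])$; linear operators are symmetric if $Q(AX,Y)=Q(X,AY)$. For symmetric $A$ and $a\in\mathbb R$, $F_a$ is the span of eigenvectors with eigenvalue $\le a$; $A$ is filtering if $[F_a,F_b]\subseteq F_{a+b}$ for all $a,b$; $\mathfrak F_+$ is the set of filtering symmetric operators with nonnegative spectrum and trace $1$. $\mathfrak h\subsetneq\mathfrak g$ is a fixed subalgebra, $\mathcal A$ a compact group of automorphisms of $\mathfrak g$ preserving $\mathfrak h$ and $Q$. $\mathcal P$ is the set of all $\mathcal A$-invariant subalgebras $\mathfrak k$ with $\mathfrak h\subsetneq\mathfrak k\subseteq\mathfrak g$, viewed as a subset of the disjoint union of the Grassmannians of $\mathfrak g$. An order ideal is a subset $\mathcal I\subseteq\mathcal P$ such that $\mathfrak l\subseteq\mathfrak j$, $\mathfrak l\in\mathcal P$, $\mathfrak j\in\mathcal I$ imply $\mathfrak l\in\mathcal I$; it is admissible if $\mathfrak g\notin\mathcal I$ and both $\mathcal I$ and $\mathcal P\setminus\mathcal I$ are compact semialgebraic. For $\mathfrak k\in\mathcal P$, $\mathfrak k\ne\mathfrak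 g$: $\bar\chi^{\mathfrak k}=\frac{1}{\dim(\mathfrak g/\mathfrak k)}(1_{\mathfrak g}-1_{\mathfrak k})$ ($1_{\mathfrak k}$ the $Q$-orthogonal projection); $D[\mathfrak k]$ is the set of symmetric operators with nonnegative spectrum and trace $1$ commuting with all elements of $\mathcal A$, annihilating $\mathfrak k$ and commuting with $\mathrm{ad}(X)$, $X\in\mathfrak k$; $X[\mathfrak k]=D[\mathfrak k]\cap\mathfrak F_+$; $D[\mathfrak g]=X[\mathfrak g]=\emptyset$. A flag is $\varphi=(\mathfrak f_1,\dots,\mathfrak f_r)$, $r\ge1$, with $\mathfrak f_i\in\mathcal P$ and $\mathfrak f_1\supsetneq\dots\supsetneq\mathfrak f_r$, identified with its set of members, $\max\varphi=\mathfrak f_1$; $\Delta(\mathcal S)$ is the set of flags with all members in $\mathcal S$. For a flag $\chi$ not containing $\mathfrak g$, $/\chi/$ is the convex hull of $\{\bar\chi^{\mathfrak f}:\mathfrak f\in\chi\}$. Butterflies: $B[(\mathfrak f)]=B[\mathfrak f]$; if $r>1$, $\mathfrak f_1=\mathfrak g$: $B[\varphi]=/(\mathfrak f_2,\dots,\mathfrak f_r)/$; if $r>1$, $\mathfrak f_1\ne\mathfrak g$: $B[\varphi]$ is the union of closed segments joining points of $B[\mathfrak f_1]$ to points of $/(\mathfrak f_2,\dots,\mathfrak f_r)/$. Set $\mathbb I=\{\varphi\in\Delta(\mathcal P)\setminus\Delta(\mathcal I):\varphi\setminus\{\max\varphi\}\subseteq\mathcal I\}$, $\mathbb J=\{\varphi\in\mathbb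 I:\mathfrak g\in\varphi\}$, and for a set $\Phi$ of flags $B[\Phi]=\bigcup_{\varphi\in\Phi}B[\varphi]$. *)

theory Defs
  imports "HOL-Analysis.Analysis"
begin

text \<open>The Euclidean inner product Q is the inner product of the euclidean_space type 'g;
  the Lie bracket is br.\<close>

definition compact_lie_alg :: "('g::euclidean_space \<Rightarrow> 'g \<Rightarrow> 'g) \<Rightarrow> bool" where
  "compact_lie_alg br \<longleftrightarrow>
     (\<forall>x. linear (br x)) \<and> (\<forall>y. linear (\<lambda>x. br x y)) \<and>
     (\<forall>x y. br x y = - br y x) \<and>
     (\<forall>x y z. br x (br y z) + br y (br z x) + br z (br x y) = 0) \<and>
     (\<forall>x y z. inner (br x y) z = inner x (br y z))"

definition lie_subalg :: "('g::euclidean_space \<Rightarrow> 'g \<Rightarrow> 'g) \<Rightarrow> 'g set \<Rightarrow> bool" where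
  "lie_subalg br k \<longleftrightarrow> subspace k \<and> (\<forall>x\<in>k. \<forall>y\<in>k. br x y \<in> k)"

definition lie_aut :: "('g::euclidean_space \<Rightarrow> 'g \<Rightarrow> 'g) \<Rightarrow> ('g \<Rightarrow>\<^sub>L 'g) \<Rightarrow> bool" where
  "lie_aut br a \<longleftrightarrow> bij (blinfun_apply a) \<and> (\<forall>x y. a (br x y) = br (a x) (a y))"

definition compact_aut_group ::
  "('g::euclidean_space \<Rightarrow> 'g \<Rightarrow> 'g) \<Rightarrow> 'g set \<Rightarrow> ('g \<Rightarrow>\<^sub>L 'g) set \<Rightarrow> bool" where
  "compact_aut_group br h AA \<longleftrightarrow>
     compact AA \<and> id_blinfun \<in> AA \<and>
     (\<forall>a\<in>AA. \<forall>b\<in>AA. a o\<^sub>L b \<in> AA) \<and>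
     (\<forall>a\<in>AA. \<exists>b\<in>AA. a o\<^sub>L b = id_blinfun \<and> b o\<^sub>L a = id_blinfun) \<and>
     (\<forall>a\<in>AA. lie_aut br a \<and> blinfun_apply a ` h = h \<and>
        (\<forall>x y. inner (a x) (a y) = inner x y))"

definition symmetric_op :: "('g::euclidean_space \<Rightarrow>\<^sub>L 'g) \<Rightarrow> bool" where
  "symmetric_op A \<longleftrightarrow> (\<forall>x y. inner (A x) y = inner x (A y))"

definition op_spectrum :: "('g::euclidean_space \<Rightarrow>\<^sub>L 'g) \<Rightarrow> real set" where
  "op_spectrum A = {l. \<exists>x. x \<noteq> 0 \<and> A x = l *\<^sub>R x}"

definition op_trace :: "('g::euclidean_space \<Rightarrow>\<^sub>L 'g) \<Rightarrow> real" where
  "op_trace A = (\<Sum>b\<in>Basis. inner (A b) b)"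

definition Fsub :: "('g::euclidean_space \<Rightarrow>\<^sub>L 'g) \<Rightarrow> real \<Rightarrow> 'g set" where
  "Fsub A a = span {x. x \<noteq> 0 \<and> (\<exists>l. l \<le> a \<and> A x = l *\<^sub>R x)}"

definition filtering :: "('g::euclidean_space \<Rightarrow> 'g \<Rightarrow> 'g) \<Rightarrow> ('g \<Rightarrow>\<^sub>L 'g) \<Rightarrow> bool" where
  "filtering br A \<longleftrightarrow>
     (\<forall>a b. \<forall>x\<in>Fsub A a. \<forall>y\<in>Fsub A b. br x y \<in> Fsub A (a + b))"

definition Fplus :: "('g::euclidean_space \<Rightarrow> 'g \<Rightarrow> 'g) \<Rightarrow> ('g \<Rightarrow>\<^sub>L 'g) set" where
  "Fplus br = {A. filtering br A \<and> symmetric_op A \<and> (\<forall>l\<in>op_spectrum A. l \<ge> 0)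
                  \<and> op_trace A = 1}"

definition orth_proj :: "'g::euclidean_space set \<Rightarrow> 'g \<Rightarrow> 'g" where
  "orth_proj k x = (SOME y. y \<in> k \<and> (\<forall>z\<in>k. inner (x - y) z = 0))"

definition projL :: "'g::euclidean_space set \<Rightarrow> ('g \<Rightarrow>\<^sub>L 'g)" where
  "projL k = Blinfun (orth_proj k)"

definition chibar :: "'g::euclidean_space set \<Rightarrow> ('g \<Rightarrow>\<^sub>L 'g)" where
  "chibar k = (1 / real (DIM('g) - dim k)) *\<^sub>R (id_blinfun - projL k)"

definition Pset ::
  "('g::euclidean_space \<Rightarrow> 'g \<Rightarrow> 'g) \<Rightarrow> 'g set \<Rightarrow> ('g \<Rightarrow>\<^sub>L 'g) set \<Rightarrow> 'g set set" where
  "Pset br h AA = {k. lie_subalg br k \<and> (\<forall>a\<in>AA. blinfun_apply a ` k \<subseteq> k) \<and> h \<subset> k}"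

inductive_set polyfun :: "(('g::euclidean_space \<Rightarrow>\<^sub>L 'g) \<Rightarrow> real) set" where
  pf_const: "(\<lambda>A. c) \<in> polyfun"
| pf_coord: "b \<in> Basis \<Longrightarrow> c \<in> Basis \<Longrightarrow> (\<lambda>A. inner (blinfun_apply A b) c) \<in> polyfun"
| pf_add: "p \<in> polyfun \<Longrightarrow> q \<in> polyfun \<Longrightarrow> (\<lambda>A. p A + q A) \<in> polyfun"
| pf_mult: "p \<in> polyfun \<Longrightarrow> q \<in> polyfun \<Longrightarrow> (\<lambda>A. p A * q A) \<in> polyfun"

inductive_set semialgebraic :: "('g::euclidean_space \<Rightarrow>\<^sub>L 'g) set set" where
  sa_zero: "p \<in> polyfun \<Longrightarrow> {A. p A = 0} \<in> semialgebraic"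
| sa_pos: "p \<in> polyfun \<Longrightarrow> {A. p A > 0} \<in> semialgebraic"
| sa_union: "S \<in> semialgebraic \<Longrightarrow> T \<in> semialgebraic \<Longrightarrow> S \<union> T \<in> semialgebraic"
| sa_compl: "S \<in> semialgebraic \<Longrightarrow> - S \<in> semialgebraic"

text \<open>A set of subspaces is viewed as a subset of the disjoint union of Grassmannians
  via k \<mapsto> 1_k.\<close>
definition compact_semialg_subspaces :: "'g::euclidean_space set set \<Rightarrow> bool" where
  "compact_semialg_subspaces S \<longleftrightarrow> compact (projL ` S) \<and> projL ` S \<in> semialgebraic"

definition order_ideal :: "'g set set \<Rightarrow> 'g set set \<Rightarrow> bool" where
  "order_ideal P I \<longleftrightarrow> I \<subseteq> P \<and> (\<forall>l j. l \<in> P \<and> j \<in> I \<and> l \<subseteq> j \<longrightarrow> l \<in> I)"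

definition admissible :: "'g::euclidean_space set set \<Rightarrow> 'g set set \<Rightarrow> bool" where
  "admissible P I \<longleftrightarrow> order_ideal P I \<and> UNIV \<notin> I \<and>
     compact_semialg_subspaces I \<and> compact_semialg_subspaces (P - I)"

definition Dset ::
  "('g::euclidean_space \<Rightarrow> 'g \<Rightarrow> 'g) \<Rightarrow> ('g \<Rightarrow>\<^sub>L 'g) set \<Rightarrow> 'g set \<Rightarrow> ('g \<Rightarrow>\<^sub>L 'g) set" where
  "Dset br AA k = (if k = UNIV then {} else
     {A. symmetric_op A \<and> (\<forall>l\<in>op_spectrum A. l \<ge> 0) \<and> op_trace A = 1 \<and>
         (\<forall>a\<in>AA. A o\<^sub>L a = a o\<^sub>L A) \<and> (\<forall>x\<in>k. A x = 0) \<and>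
         (\<forall>X\<in>k. \<forall>y. A (br X y) = br X (A y))})"

definition Xset ::
  "('g::euclidean_space \<Rightarrow> 'g \<Rightarrow> 'g) \<Rightarrow> ('g \<Rightarrow>\<^sub>L 'g) set \<Rightarrow> 'g set \<Rightarrow> ('g \<Rightarrow>\<^sub>L 'g) set" where
  "Xset br AA k = Dset br AA k \<inter> Fplus br"

definition flags :: "'g set set \<Rightarrow> 'g set list set" where
  "flags S = {\<phi>. \<phi> \<noteq> [] \<and> sorted_wrt (\<lambda>a b. b \<subset> a) \<phi> \<and> set \<phi> \<subseteq> S}"

definition flag_hull :: "'g::euclidean_space set list \<Rightarrow> ('g \<Rightarrow>\<^sub>L 'g) set" where
  "flag_hull ch = convex hull (chibar ` set ch)"

definition butterfly ::
  "('g::euclidean_space set \<Rightarrow> ('g \<Rightarrow>\<^sub>L 'g) set) \<Rightarrow> 'g set list \<Rightarrow> ('g \<Rightarrow>\<^sub>L 'g) set" where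
  "butterfly B \<phi> =
     (if tl \<phi> = [] then B (hd \<phi>)
      else if hd \<phi> = UNIV then flag_hull (tl \<phi>)
      else \<Union>{closed_segment p q | p q. p \<in> B (hd \<phi>) \<and> q \<in> flag_hull (tl \<phi>)})"

definition butterflies ::
  "('g::euclidean_space set \<Rightarrow> ('g \<Rightarrow>\<^sub>L 'g) set) \<Rightarrow> 'g set list set \<Rightarrow> ('g \<Rightarrow>\<^sub>L 'g) set" where
  "butterflies B \<Phi> = (\<Union>\<phi>\<in>\<Phi>. butterfly B \<phi>)"

definition flagsI :: "'g set set \<Rightarrow> 'g set set \<Rightarrow> 'g set list set" where
  "flagsI P I = {\<phi> \<in> flags P - flags I. set (tl \<phi>) \<subseteq> I}"

definition flagsJ :: "'g set set \<Rightarrow> 'g set set \<Rightarrow> 'g set list set" where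
  "flagsJ P I = {\<phi> \<in> flagsI P I. UNIV \<in> set \<phi>}"

definition strong_deformation_retract :: "'a::topological_space set \<Rightarrow> 'a set \<Rightarrow> bool" where
  "strong_deformation_retract A X \<longleftrightarrow>
     (\<exists>r. retraction X A r \<and> homotopic_with_canon (\<lambda>f. \<forall>a\<in>A. f a = a) X X id r)"

end

theory Submission
  imports Defs
begin

text \<open>A point of the space is \<open>A = (1 - t) p + t q\<close> with \<open>t < 1\<close>, where \<open>p\<close> is positive semidefinite
  of trace 1 and annihilates some \<open>u\<close> outside the ideal, and \<open>q\<close> is a convex combination of
  operators \<open>chibar f\<close> over a chain of \<open>f \<subseteq> u\<close> in the ideal. Write \<open>t q = l - N\<close> with a
  combination \<open>N\<close> of projections onto the members of the chain. Below the level \<open>l\<close> the spectral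
  filtration of \<open>A\<close> consists of members of the ideal, while at the level \<open>l\<close> it contains \<open>u\<close>, so \<open>l\<close>
  depends only on \<open>A\<close>; and then \<open>(1 - t) p\<close> and \<open>N\<close> are the positive and negative parts of
  \<open>A - l\<close>. Compactness of the ideal and of its complement makes the graph of \<open>A \<mapsto> (1 - t) p\<close>
  compact, so this map is continuous. The retraction is \<open>A \<mapsto> p\<close>, and the deformation moves along
  straight segments. On the simplices that are removed, \<open>t = 1\<close> and \<open>p\<close> is undefined.\<close>

section \<open>Traces and positive semidefinite operators\<close>

lemma op_trace_add [simp]: "op_trace (A + B) = op_trace A + op_trace B"
  by (simp add: op_trace_def blinfun.bilinear_simps inner_add_left sum.distrib)

lemma op_trace_diff [simp]: "op_trace (A - B) = op_trace A - op_trace B"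
  by (simp add: op_trace_def blinfun.bilinear_simps inner_diff_left sum_subtractf)

lemma op_trace_scaleR [simp]: "op_trace (c *\<^sub>R A) = c * op_trace A"
  by (simp add: op_trace_def blinfun.bilinear_simps sum_distrib_left)

lemma op_trace_0 [simp]: "op_trace 0 = 0"
  by (simp add: op_trace_def)

lemma op_trace_id [simp]: "op_trace (id_blinfun :: 'g::euclidean_space \<Rightarrow>\<^sub>L 'g) = real DIM('g)"
  by (simp add: op_trace_def inner_Basis)

lemma continuous_on_op_trace [continuous_intros]:
  "continuous_on S f \<Longrightarrow> continuous_on S (\<lambda>x. op_trace (f x))"
  unfolding op_trace_def by (intro continuous_intros)

lemma blinfun_compose_assoc: "(A o\<^sub>L B) o\<^sub>L C = A o\<^sub>L (B o\<^sub>L C)"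
  by (rule blinfun_eqI) simp

lemma op_trace_compose_commute:
  fixes S T :: "'g::euclidean_space \<Rightarrow>\<^sub>L 'g"
  shows "op_trace (S o\<^sub>L T) = op_trace (T o\<^sub>L S)"
proof -
  have expand: "op_trace (S o\<^sub>L T) = (\<Sum>b\<in>Basis. \<Sum>c\<in>Basis. (T b \<bullet> c) * (S c \<bullet> b))"
    for S T :: "'g \<Rightarrow>\<^sub>L 'g"
  proof -
    have "S (T b) \<bullet> b = (\<Sum>c\<in>Basis. (T b \<bullet> c) * (S c \<bullet> b))" for b
    proof -
      have "S (T b) = S (\<Sum>c\<in>Basis. (T b \<bullet> c) *\<^sub>R c)"
        by (simp add: euclidean_representation)
      then show ?thesis
        by (simp add: blinfun.bilinear_simps inner_sum_left)
    qed
    then show ?thesis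
      by (simp add: op_trace_def)
  qed
  show ?thesis
    unfolding expand by (subst sum.swap) (simp add: mult.commute)
qed

definition psd :: "('g::euclidean_space \<Rightarrow>\<^sub>L 'g) \<Rightarrow> bool" where
  "psd A \<longleftrightarrow> symmetric_op A \<and> (\<forall>x. 0 \<le> A x \<bullet> x)"

lemma psd_0 [simp]: "psd 0"
  by (simp add: psd_def symmetric_op_def)

lemma psd_scaleR: "0 \<le> c \<Longrightarrow> psd A \<Longrightarrow> psd (c *\<^sub>R A)"
  unfolding psd_def symmetric_op_def blinfun.bilinear_simps inner_scaleR_left inner_scaleR_right
  by (metis mult_nonneg_nonneg)

lemma symmetric_op_trace_square:
  "symmetric_op E \<Longrightarrow> op_trace (E o\<^sub>L E) = (\<Sum>b\<in>Basis. (norm (E b))\<^sup>2)"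
  by (simp add: op_trace_def symmetric_op_def power2_norm_eq_inner)

text \<open>Idempotence and cyclicity turn the trace into that of the compression
  \<open>p A p\<close>, whose diagonal entries are values of the quadratic form of
  \<open>A\<close>.\<close>

lemma op_trace_psd_projection_nonneg:
  assumes "psd A" "symmetric_op p" "p o\<^sub>L p = p"
  shows "0 \<le> op_trace (A o\<^sub>L p)"
proof -
  have "op_trace (A o\<^sub>L p) = op_trace ((A o\<^sub>L p) o\<^sub>L p)"
    by (metis assms(3) blinfun_compose_assoc)
  also have "\<dots> = op_trace (p o\<^sub>L (A o\<^sub>L p))"
    by (rule op_trace_compose_commute)
  also have "\<dots> = (\<Sum>b\<in>Basis. A (p b) \<bullet> p b)"
    using assms(2) by (simp add: op_trace_def symmetric_op_def)
  also have "\<dots> \<ge> 0"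
    using assms(1) by (simp add: psd_def sum_nonneg)
  finally show ?thesis .
qed

text \<open>The Rayleigh quotient attains its minimum, at an eigenvector.\<close>

lemma psd_if_spectrum_nonneg:
  fixes A :: "'g::euclidean_space \<Rightarrow>\<^sub>L 'g"
  assumes sym: "symmetric_op A" and spec: "\<forall>l\<in>op_spectrum A. 0 \<le> l"
  shows "psd A"
proof -
  have "compact (sphere (0::'g) 1)" "sphere (0::'g) 1 \<noteq> {}"
    by auto
  moreover have "continuous_on (sphere 0 1) (\<lambda>x. A x \<bullet> x)"
    by (intro continuous_intros)
  ultimately obtain u where u: "norm u = 1"
    and min: "\<And>x. norm x = 1 \<Longrightarrow> A u \<bullet> u \<le> A x \<bullet> x"
    using continuous_attains_inf[of "sphere (0::'g) 1" "\<lambda>x. A x \<bullet> x"] by auto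
  define m where "m = A u \<bullet> u"
  have ge: "m * (x \<bullet> x) \<le> A x \<bullet> x" for x
  proof (cases "x = 0")
    case False
    have "m \<le> A (x /\<^sub>R norm x) \<bullet> (x /\<^sub>R norm x)"
      unfolding m_def by (rule min) (use False in simp)
    also have "\<dots> = (A x \<bullet> x) / (x \<bullet> x)"
      by (simp add: blinfun.bilinear_simps divide_simps power2_norm_eq_inner flip: power2_eq_square)
    finally show ?thesis
      using False by (simp add: pos_le_divide_eq)
  qed simp
  have uu: "u \<bullet> u = 1"
    using u by (simp add: norm_eq_1)
  define v where "v = A u - m *\<^sub>R u"
  have uv: "u \<bullet> v = 0"
    by (simp add: v_def inner_diff_right m_def uu inner_commute)
  have Auv: "A u \<bullet> v = v \<bullet> v"
    using uv by (simp add: v_def inner_diff_left inner_diff_right inner_commute)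
  have Avu: "A v \<bullet> u = v \<bullet> v"
    using Auv sym by (simp add: symmetric_op_def inner_commute)
  \<comment> \<open>Compares the form at \<open>u - t v\<close> with the minimum at
    \<open>u\<close>. The residual \<open>v\<close> is orthogonal to \<open>u\<close>, so moving
    against it lowers the value to first order unless \<open>v = 0\<close>.\<close>
  have key: "0 \<le> - 2 * t * (v \<bullet> v) + t\<^sup>2 * (A v \<bullet> v - m * (v \<bullet> v))" for t
    using ge[of "u - t *\<^sub>R v"] uv uu Auv Avu
    by (simp add: blinfun.bilinear_simps inner_diff_left inner_diff_right inner_commute
        m_def power2_eq_square algebra_simps)
  have "v \<bullet> v = 0"
  proof (rule ccontr)
    assume "v \<bullet> v \<noteq> 0"
    then have pos: "v \<bullet> v > 0"
      using inner_ge_zero[of v] by linarith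
    define c where "c = A v \<bullet> v - m * (v \<bullet> v)"
    have "c \<ge> 0"
      unfolding c_def using ge[of v] by simp
    \<comment> \<open>A step size with \<open>t * c\<close> at most \<open>v \<bullet> v\<close>, so
      that the linear term of \<open>key\<close> outweighs the quadratic one; the \<open>+ 1\<close>
      covers \<open>c = 0\<close>.\<close>
    define t where "t = (v \<bullet> v) / (c + 1)"
    have t: "t > 0" "t * c \<le> v \<bullet> v"
      using pos \<open>c \<ge> 0\<close> by (simp_all add: t_def field_simps)
    have "0 \<le> - 2 * t * (v \<bullet> v) + t * (t * c)"
      using key[of t] by (simp add: c_def power2_eq_square mult.assoc)
    also have "\<dots> \<le> - 2 * t * (v \<bullet> v) + t * (v \<bullet> v)"
      using t by simp
    also have "\<dots> < 0"
      using t(1) pos by simp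
    finally show False by simp
  qed
  then have "A u = m *\<^sub>R u"
    by (simp add: v_def)
  moreover have "u \<noteq> 0"
    using u by auto
  ultimately have "m \<ge> 0"
    using spec by (auto simp: op_spectrum_def)
  then have "0 \<le> A x \<bullet> x" for x
    using ge[of x] by (smt (verit) inner_ge_zero mult_nonneg_nonneg)
  with sym show ?thesis
    by (simp add: psd_def)
qed

text \<open>Positivity at \<open>b + c\<close> and \<open>b - c\<close> bounds twice the entry by
  the sum of two diagonal entries, each at most the trace.\<close>

lemma psd_entry_le_trace:
  assumes "psd A" "b \<in> Basis" "c \<in> Basis"
  shows "\<bar>A b \<bullet> c\<bar> \<le> op_trace A"
proof -
  have diag: "A b \<bullet> b \<le> op_trace A" if "b \<in> Basis" for b
    unfolding op_trace_def using assms(1) that by (intro member_le_sum) (auto simp: psd_def)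
  have "A c \<bullet> b = A b \<bullet> c"
    using assms(1) by (simp add: psd_def symmetric_op_def inner_commute)
  moreover have "0 \<le> A (b + c) \<bullet> (b + c)" "0 \<le> A (b - c) \<bullet> (b - c)"
    using assms(1) by (simp_all add: psd_def)
  ultimately show ?thesis
    using diag[OF assms(2)] diag[OF assms(3)]
    by (simp add: blinfun.bilinear_simps inner_add_left inner_add_right inner_diff_left
        inner_diff_right)
qed

lemma compact_psd_trace_le: "compact {A :: 'g::euclidean_space \<Rightarrow>\<^sub>L 'g. psd A \<and> op_trace A \<le> c}"
proof -
  have "norm A \<le> (\<Sum>b\<in>(Basis::'g set). \<Sum>c'\<in>(Basis::'g set). c)"
    if "psd A" "op_trace A \<le> c" for A :: "'g \<Rightarrow>\<^sub>L 'g"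
  proof -
    have "norm (A b) \<le> (\<Sum>c'\<in>(Basis::'g set). c)" if b: "b \<in> Basis" for b
    proof -
      have "norm (A b) \<le> (\<Sum>c'\<in>Basis. \<bar>A b \<bullet> c'\<bar>)"
        by (rule norm_le_l1)
      also have "\<dots> \<le> (\<Sum>c'\<in>(Basis::'g set). c)"
        using psd_entry_le_trace[OF \<open>psd A\<close> b] \<open>op_trace A \<le> c\<close>
        by (intro sum_mono) force
      finally show ?thesis .
    qed
    then have "(\<Sum>b\<in>Basis. norm (A b)) \<le> (\<Sum>b\<in>(Basis::'g set). \<Sum>c'\<in>(Basis::'g set). c)"
      by (intro sum_mono)
    with norm_blinfun_euclidean_le[of A] show ?thesis
      by linarith
  qed
  then have "bounded {A :: 'g \<Rightarrow>\<^sub>L 'g. psd A \<and> op_trace A \<le> c}"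
    by (intro boundedI) auto
  moreover have "closed {A :: 'g \<Rightarrow>\<^sub>L 'g. psd A \<and> op_trace A \<le> c}"
    unfolding psd_def symmetric_op_def
    by (intro closed_Collect_conj closed_Collect_all closed_Collect_eq closed_Collect_le
        continuous_intros)
  ultimately show ?thesis
    by (simp add: compact_eq_bounded_closed)
qed

text \<open>The trace of \<open>p q A\<close> is evaluated once as a trace over the range of \<open>q p\<close> and once as a
  trace over the range of \<open>p q\<close>.\<close>

lemma invariant_projections_orthogonal:
  fixes A p q :: "'g::euclidean_space \<Rightarrow>\<^sub>L 'g"
  assumes p: "symmetric_op p" "p o\<^sub>L p = p" "A o\<^sub>L p = p o\<^sub>L A"
    and q: "symmetric_op q" "q o\<^sub>L q = q" "A o\<^sub>L q = q o\<^sub>L A"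
    and le: "\<And>x. A (p x) \<bullet> p x \<le> l * (p x \<bullet> p x)"
    and ge: "\<And>x. m * (q x \<bullet> q x) \<le> A (q x) \<bullet> q x"
    and "l < m"
  shows "q o\<^sub>L p = 0"
proof -
  have pw: "p (p x) = p x" "A (p x) = p (A x)" "q (q x) = q x" "A (q x) = q (A x)" for x
    by (simp_all add: p q flip: blinfun_apply_blinfun_compose)
  have sp: "p x \<bullet> y = x \<bullet> p y" and sq: "q x \<bullet> y = x \<bullet> q y" for x y
    using p q by (simp_all add: symmetric_op_def)
  define T where "T = (\<Sum>b\<in>Basis. q (p b) \<bullet> q (p b))"
  have T: "T = op_trace ((p o\<^sub>L q) o\<^sub>L p)"
    by (simp add: T_def op_trace_def sp sq pw)
  have T': "T = (\<Sum>b\<in>Basis. p (q b) \<bullet> p (q b))"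
  proof -
    have "T = op_trace (p o\<^sub>L (p o\<^sub>L q))"
      unfolding T by (rule op_trace_compose_commute)
    also have "\<dots> = op_trace ((p o\<^sub>L q) o\<^sub>L q)"
      by (intro arg_cong[where f = op_trace] blinfun_eqI) (simp add: pw)
    also have "\<dots> = op_trace (q o\<^sub>L (p o\<^sub>L q))"
      by (rule op_trace_compose_commute)
    also have "\<dots> = (\<Sum>b\<in>Basis. p (q b) \<bullet> p (q b))"
      by (simp add: op_trace_def sp sq pw)
    finally show ?thesis .
  qed
  have "m * T \<le> (\<Sum>b\<in>Basis. A (q (p b)) \<bullet> q (p b))"
    unfolding T_def sum_distrib_left by (intro sum_mono ge)
  also have "\<dots> = op_trace ((p o\<^sub>L (q o\<^sub>L A)) o\<^sub>L p)"
    by (simp add: op_trace_def sp sq pw)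
  also have "\<dots> = op_trace (p o\<^sub>L (p o\<^sub>L (q o\<^sub>L A)))"
    by (rule op_trace_compose_commute)
  also have "\<dots> = op_trace ((p o\<^sub>L (A o\<^sub>L q)) o\<^sub>L q)"
    by (intro arg_cong[where f = op_trace] blinfun_eqI) (simp add: pw)
  also have "\<dots> = op_trace (q o\<^sub>L (p o\<^sub>L (A o\<^sub>L q)))"
    by (rule op_trace_compose_commute)
  also have "\<dots> = (\<Sum>b\<in>Basis. A (p (q b)) \<bullet> p (q b))"
    by (simp add: op_trace_def sp sq pw)
  also have "\<dots> \<le> l * T"
    unfolding T' sum_distrib_left by (intro sum_mono le)
  finally have "m * T \<le> l * T" .
  moreover have "T \<ge> 0"
    by (simp add: T_def sum_nonneg)
  ultimately have "T = 0"
    using \<open>l < m\<close> by (smt (verit) mult_strict_right_mono)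
  then have "\<forall>b\<in>Basis. q (p b) \<bullet> q (p b) = 0"
    unfolding T_def by (subst (asm) sum_nonneg_eq_0_iff) auto
  then show ?thesis
    by (intro blinfun_euclidean_eqI) simp
qed

section \<open>Orthogonal projections\<close>

lemma orth_proj_unique:
  assumes "subspace k" "y \<in> k" "\<And>z. z \<in> k \<Longrightarrow> (x - y) \<bullet> z = 0"
  shows "orth_proj k x = y"
  unfolding orth_proj_def
proof (rule some_equality)
  show "y \<in> k \<and> (\<forall>z\<in>k. (x - y) \<bullet> z = 0)"
    using assms by blast
  fix y' assume y': "y' \<in> k \<and> (\<forall>z\<in>k. (x - y') \<bullet> z = 0)"
  have "y' - y \<in> k"
    using assms y' by (simp add: subspace_diff)
  then have "(x - y) \<bullet> (y' - y) = 0" "(x - y') \<bullet> (y' - y) = 0"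
    using assms y' by auto
  then have "(y' - y) \<bullet> (y' - y) = 0"
    by (simp add: inner_diff_left)
  then show "y' = y" by simp
qed

lemma orth_proj_char:
  assumes "subspace k"
  shows "orth_proj k x \<in> k" "z \<in> k \<Longrightarrow> (x - orth_proj k x) \<bullet> z = 0"
proof -
  obtain y w where "y \<in> span k" and w: "\<And>v. v \<in> span k \<Longrightarrow> orthogonal w v" and x: "x = y + w"
    using orthogonal_subspace_decomp_exists by blast
  then have y: "y \<in> k" "\<And>z. z \<in> k \<Longrightarrow> (x - y) \<bullet> z = 0"
    using assms by (auto simp: span_eq_iff[THEN iffD2] orthogonal_def)
  then have "orth_proj k x = y"
    using assms by (intro orth_proj_unique)
  with y show "orth_proj k x \<in> k" "z \<in> k \<Longrightarrow> (x - orth_proj k x) \<bullet> z = 0"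
    by auto
qed

lemma blinfun_apply_projL:
  assumes "subspace k"
  shows "blinfun_apply (projL k) = orth_proj k"
proof -
  have "linear (orth_proj k)"
  proof (rule linearI)
    show "orth_proj k (x + y) = orth_proj k x + orth_proj k y" for x y
    proof (rule orth_proj_unique[OF assms])
      show "orth_proj k x + orth_proj k y \<in> k"
        using assms by (simp add: orth_proj_char subspace_add)
      show "(x + y - (orth_proj k x + orth_proj k y)) \<bullet> z = 0" if "z \<in> k" for z
        using orth_proj_char(2)[OF assms that, of x] orth_proj_char(2)[OF assms that, of y]
        by (simp add: inner_diff_left inner_add_left)
    qed
    show "orth_proj k (c *\<^sub>R x) = c *\<^sub>R orth_proj k x" for c x
    proof (rule orth_proj_unique[OF assms])
      show "c *\<^sub>R orth_proj k x \<in> k"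
        using assms by (simp add: orth_proj_char subspace_scale)
      show "(c *\<^sub>R x - c *\<^sub>R orth_proj k x) \<bullet> z = 0" if "z \<in> k" for z
        using orth_proj_char(2)[OF assms that, of x] by (simp add: inner_diff_left)
    qed
  qed
  then show ?thesis
    unfolding projL_def
    by (intro bounded_linear_Blinfun_apply) (simp add: linear_conv_bounded_linear)
qed

lemma projL_in: "subspace k \<Longrightarrow> projL k x \<in> k"
  by (simp add: blinfun_apply_projL orth_proj_char)

lemma projL_orthogonal: "subspace k \<Longrightarrow> z \<in> k \<Longrightarrow> (x - projL k x) \<bullet> z = 0"
  by (simp add: blinfun_apply_projL orth_proj_char)

lemma projL_fixed_iff:
  assumes "subspace k"
  shows "projL k x = x \<longleftrightarrow> x \<in> k"
proof
  show "x \<in> k" if "projL k x = x"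
    using projL_in[OF assms, of x] that by simp
  show "projL k x = x" if "x \<in> k"
    using assms that by (simp add: blinfun_apply_projL orth_proj_unique)
qed

lemma projL_idem: "subspace k \<Longrightarrow> projL k o\<^sub>L projL k = projL k"
  by (intro blinfun_eqI) (simp add: projL_fixed_iff projL_in)

text \<open>The right-hand side is symmetric in \<open>x\<close> and \<open>y\<close> and
  nonnegative for \<open>x = y\<close>; this yields both \<open>symmetric_projL\<close> and
  \<open>psd_projL\<close>.\<close>

lemma inner_projL_left:
  assumes "subspace k"
  shows "projL k x \<bullet> y = projL k x \<bullet> projL k y"
  using projL_orthogonal[OF assms projL_in[OF assms, of x], of y]
  by (simp add: inner_diff_right inner_commute[of "y - projL k y"])

lemma symmetric_projL:
  assumes "subspace k"
  shows "symmetric_op (projL k)"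
  unfolding symmetric_op_def by (metis assms inner_projL_left inner_commute)

lemma psd_projL: "subspace k \<Longrightarrow> psd (projL k)"
  unfolding psd_def by (metis symmetric_projL inner_projL_left inner_ge_zero)

text \<open>Encodes inclusion of subspaces as an equation between operators, hence as a closed
  condition on the Grassmannians.\<close>

lemma projL_compose_eq_iff:
  assumes "subspace f" "subspace g"
  shows "projL f o\<^sub>L projL g = projL g \<longleftrightarrow> g \<subseteq> f"
proof
  assume eq: "projL f o\<^sub>L projL g = projL g"
  show "g \<subseteq> f"
  proof
    fix x assume "x \<in> g"
    then have "projL f x = x"
      using eq assms by (metis blinfun_apply_blinfun_compose projL_fixed_iff)
    then show "x \<in> f"
      using assms by (simp add: projL_fixed_iff)
  qed
next
  assume "g \<subseteq> f"
  then show "projL f o\<^sub>L projL g = projL g"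
    using assms by (intro blinfun_eqI) (auto simp: projL_fixed_iff projL_in)
qed

text \<open>By symmetry the orthogonal complement of \<open>k\<close> is invariant as well.\<close>

lemma projL_commute:
  assumes k: "subspace k" and A: "symmetric_op A" "\<And>x. x \<in> k \<Longrightarrow> A x \<in> k"
  shows "A o\<^sub>L projL k = projL k o\<^sub>L A"
proof (rule blinfun_eqI)
  fix x
  have "orth_proj k (A x) = A (projL k x)"
  proof (rule orth_proj_unique[OF k])
    show "A (projL k x) \<in> k"
      using k A by (simp add: projL_in)
    fix z assume "z \<in> k"
    then have "(x - projL k x) \<bullet> A z = 0"
      using k A by (simp add: projL_orthogonal)
    then show "(A x - A (projL k x)) \<bullet> z = 0"
      using A(1) by (simp add: symmetric_op_def inner_diff_left)
  qed
  then show "(A o\<^sub>L projL k) x = (projL k o\<^sub>L A) x"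
    using k by (simp add: blinfun_apply_projL)
qed

text \<open>Expand the projection in an orthonormal basis \<open>E\<close> of \<open>k\<close>: by
  Parseval each basis vector contributes 1 to the trace.\<close>

lemma op_trace_projL:
  fixes k :: "'g::euclidean_space set"
  assumes k: "subspace k"
  shows "op_trace (projL k) = real (dim k)"
proof -
  obtain E where E: "E \<subseteq> k" "pairwise orthogonal E" "\<And>x. x \<in> E \<Longrightarrow> norm x = 1"
    "independent E" "card E = dim k" "span E = k"
    using orthonormal_basis_subspace[OF k] by blast
  have fin: "finite E"
    using E(4) by (rule independent_imp_finite)
  have proj: "projL k x = (\<Sum>e\<in>E. (x \<bullet> e) *\<^sub>R e)" for x
    unfolding blinfun_apply_projL[OF k]
  proof (rule orth_proj_unique[OF k])
    show "(\<Sum>e\<in>E. (x \<bullet> e) *\<^sub>R e) \<in> k"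
      using E(1) by (intro subspace_sum subspace_scale k) auto
    have ortho: "(x - (\<Sum>e\<in>E. (x \<bullet> e) *\<^sub>R e)) \<bullet> d = 0" if "d \<in> E" for d
    proof -
      have "(\<Sum>e\<in>E. (x \<bullet> e) *\<^sub>R e) \<bullet> d = (\<Sum>e\<in>E. if e = d then x \<bullet> d else 0)"
        unfolding inner_sum_left
      proof (rule sum.cong[OF refl])
        fix e assume "e \<in> E"
        with that E(2,3) show "(x \<bullet> e) *\<^sub>R e \<bullet> d = (if e = d then x \<bullet> d else 0)"
          by (auto simp: pairwise_def orthogonal_def norm_eq_1)
      qed
      then show ?thesis
        using that fin by (simp add: inner_diff_left)
    qed
    fix z assume "z \<in> k"
    then have "z \<in> span E"
      by (simp add: E(6))
    then show "(x - (\<Sum>e\<in>E. (x \<bullet> e) *\<^sub>R e)) \<bullet> z = 0"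
      by (induction rule: span_induct)
        (auto simp: subspace_def inner_add_right ortho)
  qed
  have "op_trace (projL k) = (\<Sum>b\<in>Basis. \<Sum>e\<in>E. (e \<bullet> b) * (e \<bullet> b))"
    unfolding op_trace_def proj inner_sum_left by (simp add: inner_commute)
  also have "\<dots> = (\<Sum>e\<in>E. e \<bullet> e)"
    by (subst sum.swap) (simp add: euclidean_inner[of e e for e])
  also have "\<dots> = real (dim k)"
    using E(3,5) by (simp add: norm_eq_1)
  finally show ?thesis .
qed

section \<open>Splitting an operator along an ideal of subspaces\<close>

text \<open>The trace condition is carried along so that it is verified only for projections and
  then passes to nonnegative combinations; it controls the mixed terms in
  \<open>upper_part_unique\<close>.\<close>

definition proj_cone :: "'g::euclidean_space set \<Rightarrow> ('g \<Rightarrow>\<^sub>L 'g) set" where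
  "proj_cone f = {N. psd N \<and> (\<forall>x. N x \<in> f) \<and> (\<forall>P. psd P \<longrightarrow> 0 \<le> op_trace (P o\<^sub>L N))}"

lemma projL_in_proj_cone: "subspace f \<Longrightarrow> projL f \<in> proj_cone f"
  by (simp add: proj_cone_def psd_projL projL_in op_trace_psd_projection_nonneg symmetric_projL
      projL_idem)

lemma proj_cone_mono: "f \<subseteq> g \<Longrightarrow> proj_cone f \<subseteq> proj_cone g"
  by (auto simp: proj_cone_def)

lemma proj_cone_combination:
  fixes N M :: "'g::euclidean_space \<Rightarrow>\<^sub>L 'g"
  assumes f: "subspace f" and N: "N \<in> proj_cone f" "M \<in> proj_cone f" and ab: "0 \<le> a" "0 \<le> b"
  shows "a *\<^sub>R N + b *\<^sub>R M \<in> proj_cone f"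
proof -
  have "psd (a *\<^sub>R N)" "psd (b *\<^sub>R M)"
    using N ab by (simp_all add: proj_cone_def psd_scaleR)
  then have "psd (a *\<^sub>R N + b *\<^sub>R M)"
    unfolding psd_def symmetric_op_def blinfun.bilinear_simps inner_add_left inner_add_right
    by (metis add_nonneg_nonneg)
  moreover have "P o\<^sub>L (a *\<^sub>R N + b *\<^sub>R M) = (a *\<^sub>R (P o\<^sub>L N)) + (b *\<^sub>R (P o\<^sub>L M))"
    for P :: "'g \<Rightarrow>\<^sub>L 'g"
    by (rule blinfun_eqI) (simp add: blinfun.bilinear_simps)
  ultimately show ?thesis
    using f N ab by (simp add: proj_cone_def blinfun.bilinear_simps subspace_add subspace_scale)
qed

lemma proj_cone_orthogonal:
  assumes "N \<in> proj_cone f" "\<And>z. z \<in> f \<Longrightarrow> x \<bullet> z = 0"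
  shows "N x = 0"
proof -
  have "N x \<bullet> N x = x \<bullet> N (N x)"
    using assms(1) by (simp add: proj_cone_def psd_def symmetric_op_def)
  also have "\<dots> = 0"
    using assms by (simp add: proj_cone_def)
  finally show ?thesis by simp
qed

text \<open>\<open>chibar\<close> as a function of the projection, with the dimension read as a
  trace, so that continuity on the Grassmannians becomes visible.\<close>

definition cochi :: "('g::euclidean_space \<Rightarrow>\<^sub>L 'g) \<Rightarrow> ('g \<Rightarrow>\<^sub>L 'g)" where
  "cochi p = (1 / (real DIM('g) - op_trace p)) *\<^sub>R (id_blinfun - p)"

lemma chibar_eq_cochi:
  fixes f :: "'g::euclidean_space set"
  assumes "subspace f"
  shows "chibar f = cochi (projL f)"
  using dim_subset_UNIV[of f] assms by (simp add: chibar_def cochi_def op_trace_projL of_nat_diff)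

text \<open>\<open>I\<close> stands for the order ideal and \<open>U\<close> for its complement in
  \<open>Pset\<close>; downward closure of the ideal appears as
  \<open>U_not_below_I\<close>.\<close>

locale subspace_ideal =
  fixes I U :: "'g::euclidean_space set set"
  assumes subspace_I: "f \<in> I \<Longrightarrow> subspace f"
    and subspace_U: "u \<in> U \<Longrightarrow> subspace u"
    and U_not_below_I: "u \<in> U \<Longrightarrow> f \<in> I \<Longrightarrow> \<not> u \<subseteq> f"
    and UNIV_in_U: "UNIV \<in> U"
    and compact_I: "compact (projL ` I)"
    and compact_U: "compact (projL ` U)"
begin

text \<open>\<open>l *\<^sub>R id_blinfun - N\<close> is the truncation of the operator at \<open>l\<close> in the sense of functional
  calculus.\<close>

definition low_part :: "'g set \<Rightarrow> real \<Rightarrow> ('g \<Rightarrow>\<^sub>L 'g) \<Rightarrow> bool" where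
  "low_part u l N \<longleftrightarrow> 0 \<le> l \<and> (l = 0 \<and> N = 0 \<or> (\<exists>f\<in>I. f \<subseteq> u \<and> N \<in> proj_cone f))"

text \<open>On \<open>u\<close> the form of \<open>A\<close> is at most \<open>l\<close>, since
  \<open>P\<close> vanishes there and \<open>N\<close> is psd. On the orthogonal complement of
  \<open>f\<close> it is at least \<open>l'\<close>, since \<open>N'\<close> vanishes there and
  \<open>P'\<close> is psd. If \<open>l < l'\<close>, the two spaces are orthogonal, so
  \<open>u \<subseteq> f\<close>, which is excluded.\<close>

lemma low_part_level_le:
  assumes u: "u \<in> U" and P: "psd P" "\<And>x. x \<in> u \<Longrightarrow> P x = 0" and lp: "low_part u l N"
    and u': "u' \<in> U" and P': "psd P'" "\<And>x. x \<in> u' \<Longrightarrow> P' x = 0" and lp': "low_part u' l' N'"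
    and eq: "P + (l *\<^sub>R id_blinfun - N) = P' + (l' *\<^sub>R id_blinfun - N')"
  shows "l' \<le> l"
proof (rule ccontr)
  assume "\<not> l' \<le> l"
  then have less: "l < l'" by simp
  define A where "A = P + (l *\<^sub>R id_blinfun - N)"
  have Ax: "A x = P x + l *\<^sub>R x - N x" "A x = P' x + l' *\<^sub>R x - N' x" for x
    by (simp add: A_def blinfun.bilinear_simps) (simp add: A_def eq blinfun.bilinear_simps)
  \<comment> \<open>\<open>l' > 0\<close> rules out the degenerate alternative of
    \<open>low_part\<close>.\<close>
  obtain f where f: "f \<in> I" "f \<subseteq> u'" "N' \<in> proj_cone f"
    using lp lp' less by (auto simp: low_part_def)
  have sf: "subspace f" and su: "subspace u"
    using f(1) u by (auto intro: subspace_I subspace_U)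
  have N: "psd N" "\<And>x. N x \<in> u"
    using lp su by (auto simp: low_part_def proj_cone_def subspace_0)
  have symA: "symmetric_op A"
    using P(1) N(1) by (simp add: symmetric_op_def psd_def Ax(1) inner_add_left inner_add_right
        inner_diff_left inner_diff_right)
  have A_u: "A x \<in> u" if "x \<in> u" for x
    using that su N(2) P(2) by (simp add: Ax(1) subspace_diff subspace_scale)
  have A_f: "A x \<in> f" if "x \<in> f" for x
    using that sf f P'(2) by (simp add: Ax(2) subspace_diff subspace_scale subset_iff proj_cone_def)
  define q where "q = id_blinfun - projL f"
  have "q o\<^sub>L projL u = 0"
  proof (rule invariant_projections_orthogonal[where A = A])
    show "symmetric_op (projL u)" "projL u o\<^sub>L projL u = projL u" "A o\<^sub>L projL u = projL u o\<^sub>L A"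
      using su symA A_u by (auto simp: symmetric_projL projL_idem intro: projL_commute)
    show "symmetric_op q"
      using symmetric_projL[OF sf]
      by (simp add: q_def symmetric_op_def blinfun.bilinear_simps inner_diff_left inner_diff_right)
    show "q o\<^sub>L q = q"
      using sf by (intro blinfun_eqI) (simp add: q_def blinfun.bilinear_simps projL_fixed_iff projL_in)
    have "A (projL f x) = projL f (A x)" for x
      using projL_commute[OF sf symA A_f] by (metis blinfun_apply_blinfun_compose)
    then show "A o\<^sub>L q = q o\<^sub>L A"
      by (intro blinfun_eqI) (simp add: q_def blinfun.bilinear_simps)
    show "A (projL u x) \<bullet> projL u x \<le> l * (projL u x \<bullet> projL u x)" for x
      using N(1) su by (simp add: Ax(1) P(2) projL_in inner_diff_left psd_def)
    show "l' * (q x \<bullet> q x) \<le> A (q x) \<bullet> q x" for x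
    proof -
      have "N' (q x) = 0"
      proof (rule proj_cone_orthogonal[OF f(3)])
        show "q x \<bullet> z = 0" if "z \<in> f" for z
          using projL_orthogonal[OF sf that, of x] by (simp add: q_def blinfun.bilinear_simps)
      qed
      then show ?thesis
        using P'(1) by (simp add: Ax(2) inner_add_left psd_def)
    qed
  qed fact
  then have "projL f o\<^sub>L projL u = projL u"
    by (intro blinfun_eqI)
      (metis (no_types, lifting) blinfun_apply_blinfun_compose blinfun.diff_left blinfun_apply_id_blinfun
        eq_iff_diff_eq_0 q_def zero_blinfun.rep_eq)
  then have "u \<subseteq> f"
    using sf su by (simp add: projL_compose_eq_iff)
  with u f(1) show False
    using U_not_below_I by blast
qed

text \<open>After the levels agree, \<open>P - N = P' - N'\<close> with \<open>P N = P' N' = 0\<close>: positive and negative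
  parts are unique.\<close>

lemma upper_part_unique:
  assumes u: "u \<in> U" and P: "psd P" "\<And>x. x \<in> u \<Longrightarrow> P x = 0" and lp: "low_part u l N"
    and u': "u' \<in> U" and P': "psd P'" "\<And>x. x \<in> u' \<Longrightarrow> P' x = 0" and lp': "low_part u' l' N'"
    and eq: "P + (l *\<^sub>R id_blinfun - N) = P' + (l' *\<^sub>R id_blinfun - N')"
  shows "P = P'"
proof -
  have "l = l'"
    using low_part_level_le[OF u P lp u' P' lp' eq] low_part_level_le[OF u' P' lp' u P lp eq[symmetric]]
    by simp
  define E where "E = P - P'"
  have E: "E = N - N'"
    using eq \<open>l = l'\<close> by (simp add: E_def algebra_simps)
  have PN: "P o\<^sub>L N = 0"
    using lp P(2) by (intro blinfun_eqI) (auto simp: low_part_def proj_cone_def)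
  have PN': "P' o\<^sub>L N' = 0"
    using lp' P'(2) by (intro blinfun_eqI) (auto simp: low_part_def proj_cone_def)
  have nonneg: "0 \<le> op_trace (P o\<^sub>L N')" "0 \<le> op_trace (P' o\<^sub>L N)"
    using lp lp' P(1) P'(1) by (auto simp: low_part_def proj_cone_def blinfun_compose_zero)
  \<comment> \<open>The two expressions for \<open>E\<close> are multiplied: the unmixed products
    vanish, and the mixed ones have nonnegative trace and enter with a minus sign. So the trace of
    the square, which is the squared Hilbert-Schmidt norm of \<open>E\<close>, is at most 0.\<close>
  have "E o\<^sub>L E = (P - P') o\<^sub>L (N - N')"
    by (simp add: E flip: E_def)
  also have "\<dots> = (P o\<^sub>L N) - (P o\<^sub>L N') - (P' o\<^sub>L N) + (P' o\<^sub>L N')"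
    by (intro blinfun_eqI) (simp add: blinfun.bilinear_simps)
  finally have "op_trace (E o\<^sub>L E) \<le> 0"
    using nonneg by (simp only: op_trace_diff op_trace_add PN PN' op_trace_0)
  moreover have "symmetric_op E"
    using P(1) P'(1)
    by (simp add: E_def symmetric_op_def psd_def blinfun.bilinear_simps inner_diff_left inner_diff_right)
  ultimately have "(\<Sum>b\<in>Basis. (norm (E b))\<^sup>2) \<le> 0"
    by (simp add: symmetric_op_trace_square)
  then have "(\<Sum>b\<in>Basis. (norm (E b))\<^sup>2) = 0"
    by (intro antisym sum_nonneg) simp_all
  then have "\<forall>b\<in>Basis. E b = 0"
    by (subst (asm) sum_nonneg_eq_0_iff) auto
  then have "E = 0"
    by (intro blinfun_euclidean_eqI) simp
  then show ?thesis
    by (simp add: E_def)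
qed

section \<open>Compactness of the simplices over chains in the ideal\<close>

lemma dim_I_less: "f \<in> I \<Longrightarrow> dim f < DIM('g)"
  using U_not_below_I[OF UNIV_in_U, of f] subspace_I[of f] dim_subset_UNIV[of f] dim_eq_full[of f]
  by (metis order_le_imp_less_or_eq span_eq_iff subset_UNIV subset_refl)

text \<open>\<open>hull_pairs m\<close> consists of the points of the simplices spanned by weakly decreasing chains of
  length \<open>m + 1\<close>, tagged with the largest member of the chain. Strict chains do not form a closed
  set.\<close>

primrec hull_pairs :: "nat \<Rightarrow> (('g \<Rightarrow>\<^sub>L 'g) \<times> ('g \<Rightarrow>\<^sub>L 'g)) set" where
  "hull_pairs 0 = (\<lambda>p. (p, cochi p)) ` projL ` I"
| "hull_pairs (Suc m) = (\<lambda>(t, p, s, q). (p, (1 - t) *\<^sub>R cochi p + t *\<^sub>R q)) `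
     {(t, p, s, q). 0 \<le> t \<and> t \<le> 1 \<and> p \<in> projL ` I \<and> (s, q) \<in> hull_pairs m \<and> p o\<^sub>L s = s}"

text \<open>The denominator stays positive on \<open>I\<close>: since \<open>UNIV\<close> lies in
  \<open>U\<close>, every member of \<open>I\<close> is a proper subspace.\<close>

lemma continuous_on_cochi: "continuous_on (projL ` I) cochi"
  unfolding cochi_def
  by (intro continuous_intros) (auto simp: op_trace_projL subspace_I dest: dim_I_less)

text \<open>At each stage the chain condition \<open>p o\<^sub>L s = s\<close> cuts a closed subset
  out of a compact product, and the new points are its continuous image.\<close>

lemma compact_hull_pairs: "compact (hull_pairs m)"
proof (induction m)
  case 0
  show ?case
    by (simp, intro compact_continuous_image continuous_intros continuous_on_cochi compact_I)
next
  case (Suc m)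
  define K where "K = {(t::real, p, s, q). 0 \<le> t \<and> t \<le> 1 \<and> p \<in> projL ` I \<and> (s, q) \<in> hull_pairs m
    \<and> p o\<^sub>L s = s}"
  have "K = ({0..1} \<times> projL ` I \<times> hull_pairs m) \<inter> {x. fst (snd x) o\<^sub>L fst (snd (snd x)) = fst (snd (snd x))}"
    by (auto simp: K_def)
  moreover have "closed {x :: real \<times> ('g \<Rightarrow>\<^sub>L 'g) \<times> ('g \<Rightarrow>\<^sub>L 'g) \<times> ('g \<Rightarrow>\<^sub>L 'g).
      fst (snd x) o\<^sub>L fst (snd (snd x)) = fst (snd (snd x))}"
    by (intro closed_Collect_eq continuous_intros)
  ultimately have "compact K"
    using Suc compact_I by (auto intro!: compact_Int_closed compact_Times)
  moreover have "continuous_on K (\<lambda>x. cochi (fst (snd x)))"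
    by (rule continuous_on_compose2[OF continuous_on_cochi])
      (auto simp: K_def intro!: continuous_intros)
  then have "continuous_on K (\<lambda>(t, p, s, q). (p, (1 - t) *\<^sub>R cochi p + t *\<^sub>R q))"
    unfolding case_prod_unfold by (intro continuous_intros)
  ultimately show ?case
    unfolding hull_pairs.simps K_def[symmetric] by (intro compact_continuous_image)
qed

text \<open>A chain is prolonged by repeating its largest member with weight 0, that is, with
  \<open>t = 1\<close>.\<close>

lemma hull_pairs_mono:
  assumes "m \<le> n"
  shows "hull_pairs m \<subseteq> hull_pairs n"
proof (rule lift_Suc_mono_le[OF _ assms])
  fix n
  show "hull_pairs n \<subseteq> hull_pairs (Suc n)"
  proof
    fix x assume x: "x \<in> hull_pairs n"
    obtain p q where pq: "x = (p, q)" by (cases x)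
    have "p \<in> projL ` I"
      using x pq by (cases n) auto
    moreover from this have "p o\<^sub>L p = p"
      by (auto simp: projL_idem subspace_I)
    ultimately show "x \<in> hull_pairs (Suc n)"
      using x pq by (auto intro!: image_eqI[where x = "(1, p, p, q)"])
  qed
qed

text \<open>Every vertex has the form \<open>l *\<^sub>R id_blinfun - N\<close> with
  \<open>N\<close> in the cone of its own subspace. These cones all lie in that of the largest
  member \<open>f\<close>, so the form survives convex combination.\<close>

lemma hull_pairsE:
  assumes "(p, q) \<in> hull_pairs m"
  obtains f l N where "f \<in> I" "p = projL f" "op_trace q = 1" "0 \<le> l" "N \<in> proj_cone f"
    "q = l *\<^sub>R id_blinfun - N"
proof -
  have cochi: "op_trace (cochi (projL f)) = 1 \<and> (\<exists>l N. 0 \<le> l \<and> N \<in> proj_cone f \<and>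
    cochi (projL f) = l *\<^sub>R id_blinfun - N)" if "f \<in> I" for f
  proof -
    define d where "d = 1 / (real DIM('g) - op_trace (projL f))"
    have pos: "real DIM('g) - op_trace (projL f) > 0"
      using dim_I_less[OF that] by (simp add: op_trace_projL subspace_I[OF that])
    then have "op_trace (cochi (projL f)) = 1"
      by (simp add: cochi_def)
    moreover have "0 \<le> d"
      using pos by (simp add: d_def)
    moreover have "d *\<^sub>R projL f \<in> proj_cone f"
      using proj_cone_combination[OF subspace_I[OF that] projL_in_proj_cone projL_in_proj_cone, of d 0]
        \<open>0 \<le> d\<close> that by (simp add: subspace_I)
    moreover have "cochi (projL f) = d *\<^sub>R id_blinfun - d *\<^sub>R projL f"
      by (simp add: cochi_def d_def scaleR_diff_right)
    ultimately show ?thesis by blast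
  qed
  have "\<exists>f\<in>I. p = projL f \<and> op_trace q = 1 \<and> (\<exists>l N. 0 \<le> l \<and> N \<in> proj_cone f \<and>
    q = l *\<^sub>R id_blinfun - N)"
    using assms
  proof (induction m arbitrary: p q)
    case 0
    then show ?case using cochi by auto
  next
    case (Suc m)
    then obtain t f s q' where t: "0 \<le> t" "t \<le> 1" and f: "f \<in> I" "p = projL f"
      and s: "(s, q') \<in> hull_pairs m" "projL f o\<^sub>L s = s"
      and q: "q = (1 - t) *\<^sub>R cochi (projL f) + t *\<^sub>R q'"
      by auto
    obtain g l' N' where g: "g \<in> I" "s = projL g" "op_trace q' = 1" "0 \<le> l'" "N' \<in> proj_cone g"
      "q' = l' *\<^sub>R id_blinfun - N'"
      using Suc.IH[OF s(1)] by blast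
    obtain l N where l: "op_trace (cochi (projL f)) = 1" "0 \<le> l" "N \<in> proj_cone f"
      "cochi (projL f) = l *\<^sub>R id_blinfun - N"
      using cochi[OF f(1)] by blast
    have "g \<subseteq> f"
      using s(2) g(1,2) f(1) by (simp add: projL_compose_eq_iff subspace_I)
    then have "(1 - t) *\<^sub>R N + t *\<^sub>R N' \<in> proj_cone f"
      using proj_cone_mono[of g f] g(5) l(3) t f(1)
      by (intro proj_cone_combination) (auto simp: subspace_I)
    moreover have "q = ((1 - t) * l + t * l') *\<^sub>R id_blinfun - ((1 - t) *\<^sub>R N + t *\<^sub>R N')"
      by (simp add: q l(4) g(6) algebra_simps)
    moreover have "0 \<le> (1 - t) * l + t * l'"
      using t l(2) g(4) by simp
    moreover have "op_trace q = 1"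
      by (simp add: q l(1) g(3))
    ultimately show ?case
      using f by blast
  qed
  then show thesis
    using that by blast
qed

text \<open>The simplex of a flag is the join of its top vertex with the simplex of the tail, which
  matches the recursion of \<open>hull_pairs\<close>.\<close>

lemma flag_hull_pairs:
  "f # fs \<in> flags I \<Longrightarrow> q \<in> flag_hull (f # fs) \<Longrightarrow> (projL f, q) \<in> hull_pairs (length fs)"
proof (induction fs arbitrary: f q)
  case Nil
  then show ?case
    by (auto simp: flag_hull_def flags_def chibar_eq_cochi subspace_I)
next
  case (Cons g gs)
  have fl: "g # gs \<in> flags I" and f: "f \<in> I" "g \<in> I" "g \<subseteq> f"
    using Cons.prems(1) by (auto simp: flags_def)
  have "q \<in> convex hull (insert (chibar f) (chibar ` set (g # gs)))"
    using Cons.prems(2) by (simp add: flag_hull_def)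
  then obtain a t b where ab: "0 \<le> a" "0 \<le> t" "a + t = 1" "b \<in> flag_hull (g # gs)"
    "q = a *\<^sub>R chibar f + t *\<^sub>R b"
    by (subst (asm) convex_hull_insert) (auto simp: flag_hull_def)
  have "(projL g, b) \<in> hull_pairs (length gs)"
    using Cons.IH[OF fl ab(4)] .
  moreover have "projL f o\<^sub>L projL g = projL g"
    using f by (simp add: projL_compose_eq_iff subspace_I)
  moreover have "q = (1 - t) *\<^sub>R cochi (projL f) + t *\<^sub>R b"
    using ab(3,5) f(1) by (simp add: chibar_eq_cochi subspace_I eq_diff_eq[symmetric])
  ultimately show ?case
    using ab(1-3) f(1) by (auto intro!: image_eqI[where x = "(t, projL f, projL g, b)"])
qed

text \<open>Dimensions drop strictly along a flag; hence the single compact set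
  \<open>hull_pairs DIM('g)\<close> accounts for all flags.\<close>

lemma flag_length_le_dim: "f # fs \<in> flags I \<Longrightarrow> length fs \<le> dim f"
proof (induction fs arbitrary: f)
  case (Cons g gs)
  then have "g # gs \<in> flags I" and f: "f \<in> I" "g \<in> I" "g \<subset> f"
    by (auto simp: flags_def)
  then have "length gs \<le> dim g"
    using Cons.IH by blast
  moreover have "dim g < dim f"
    using f by (intro dim_psubset) (metis span_eq_iff subspace_I)
  ultimately show ?case by simp
qed simp

lemma flag_hull_subset_hull_pairs:
  assumes "f # fs \<in> flags I" "q \<in> flag_hull (f # fs)"
  shows "(projL f, q) \<in> hull_pairs DIM('g)"
  using hull_pairs_mono[of "length fs" "DIM('g)"] flag_hull_pairs[OF assms]
    flag_length_le_dim[OF assms(1)] dim_subset_UNIV[of f] by auto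

section \<open>Continuity of the upper part through its compact graph\<close>

definition upper_parts :: "('g \<Rightarrow>\<^sub>L 'g) set" where
  "upper_parts = {P. psd P \<and> op_trace P \<le> 1}"

text \<open>The graph of \<open>(1 - t) p + t q \<mapsto> (1 - t) p\<close>, with the case \<open>t = 0\<close> separate because a member of
  \<open>U\<close> need not contain a member of \<open>I\<close>.\<close>

definition splitting :: "(('g \<Rightarrow>\<^sub>L 'g) \<times> ('g \<Rightarrow>\<^sub>L 'g)) set" where
  "splitting =
     (\<lambda>(v, P). (P, P)) ` {(v, P). v \<in> projL ` U \<and> P \<in> upper_parts \<and> P o\<^sub>L v = 0 \<and> op_trace P = 1} \<union>
     (\<lambda>(v, P, p, q). (P + (1 - op_trace P) *\<^sub>R q, P)) `
       {(v, P, p, q). v \<in> projL ` U \<and> P \<in> upper_parts \<and> P o\<^sub>L v = 0 \<and>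
          (p, q) \<in> hull_pairs DIM('g) \<and> v o\<^sub>L p = p}"

text \<open>All incidence conditions are equations between operators, hence closed. The value
  \<open>P = 0\<close>, that is \<open>t = 1\<close>, is included, so the graph also covers the
  removed simplices.\<close>

lemma compact_splitting: "compact splitting"
proof -
  have up: "compact upper_parts"
    unfolding upper_parts_def by (rule compact_psd_trace_le)
  define K1 where "K1 = {(v, P). v \<in> projL ` U \<and> P \<in> upper_parts \<and> P o\<^sub>L v = 0 \<and> op_trace P = 1}"
  have "K1 = (projL ` U \<times> upper_parts) \<inter> {x. snd x o\<^sub>L fst x = 0 \<and> op_trace (snd x) = 1}"
    by (auto simp: K1_def)
  moreover have "closed {x :: ('g \<Rightarrow>\<^sub>L 'g) \<times> ('g \<Rightarrow>\<^sub>L 'g). snd x o\<^sub>L fst x = 0 \<and> op_trace (snd x) = 1}"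
    by (intro closed_Collect_conj closed_Collect_eq continuous_intros)
  ultimately have "compact K1"
    using up compact_U by (auto intro!: compact_Int_closed compact_Times)
  define K2 where "K2 = {(v, P, p, q). v \<in> projL ` U \<and> P \<in> upper_parts \<and> P o\<^sub>L v = 0 \<and>
          (p, q) \<in> hull_pairs DIM('g) \<and> v o\<^sub>L p = p}"
  have "K2 = (projL ` U \<times> upper_parts \<times> hull_pairs DIM('g)) \<inter>
      {x. fst (snd x) o\<^sub>L fst x = 0 \<and> fst x o\<^sub>L fst (snd (snd x)) = fst (snd (snd x))}"
    by (auto simp: K2_def)
  moreover have "closed {x :: ('g \<Rightarrow>\<^sub>L 'g) \<times> ('g \<Rightarrow>\<^sub>L 'g) \<times> ('g \<Rightarrow>\<^sub>L 'g) \<times> ('g \<Rightarrow>\<^sub>L 'g).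
      fst (snd x) o\<^sub>L fst x = 0 \<and> fst x o\<^sub>L fst (snd (snd x)) = fst (snd (snd x))}"
    by (intro closed_Collect_conj closed_Collect_eq continuous_intros)
  ultimately have "compact K2"
    using up compact_U compact_hull_pairs by (auto intro!: compact_Int_closed compact_Times)
  have "compact ((\<lambda>(v, P). (P, P)) ` K1)"
    unfolding case_prod_unfold by (intro compact_continuous_image continuous_intros \<open>compact K1\<close>)
  moreover have "compact ((\<lambda>(v, P, p, q). (P + (1 - op_trace P) *\<^sub>R q, P)) ` K2)"
    unfolding case_prod_unfold by (intro compact_continuous_image continuous_intros \<open>compact K2\<close>)
  ultimately show ?thesis
    unfolding splitting_def K1_def[symmetric] K2_def[symmetric] by (rule compact_Un)
qed

lemma splittingE:
  assumes "(A, P) \<in> splitting"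
  obtains u l N where "u \<in> U" "psd P" "\<And>x. x \<in> u \<Longrightarrow> P x = 0" "low_part u l N"
    "A = P + (l *\<^sub>R id_blinfun - N)"
proof -
  have kill: "P x = 0" if "P o\<^sub>L projL u = 0" "u \<in> U" "x \<in> u" for u x
    using that by (metis blinfun_apply_blinfun_compose projL_fixed_iff subspace_U zero_blinfun.rep_eq)
  from assms consider
      (1) u where "u \<in> U" "P \<in> upper_parts" "P o\<^sub>L projL u = 0" "A = P"
    | (2) u p q where "u \<in> U" "P \<in> upper_parts" "P o\<^sub>L projL u = 0" "(p, q) \<in> hull_pairs DIM('g)"
        "projL u o\<^sub>L p = p" "A = P + (1 - op_trace P) *\<^sub>R q"
    unfolding splitting_def by auto
  then show thesis
  proof cases
    \<comment> \<open>Without a lower part the level is 0 and the degenerate alternative of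
      \<open>low_part\<close> applies.\<close>
    case 1
    then show ?thesis
      using that[of u 0 0] kill by (simp add: upper_parts_def low_part_def)
  next
    case 2
    obtain f l N where f: "f \<in> I" "p = projL f" "0 \<le> l" "N \<in> proj_cone f" "q = l *\<^sub>R id_blinfun - N"
      using hull_pairsE[OF 2(4)] by metis
    define t where "t = 1 - op_trace P"
    have t: "0 \<le> t"
      using 2(2) by (simp add: t_def upper_parts_def)
    have "f \<subseteq> u"
      using 2(1,5) f by (simp add: projL_compose_eq_iff subspace_I subspace_U)
    moreover have "t *\<^sub>R N \<in> proj_cone f"
      using proj_cone_combination[OF subspace_I[OF f(1)] f(4) f(4) t, of 0] by simp
    ultimately have "low_part u (t * l) (t *\<^sub>R N)"
      using t f by (auto simp: low_part_def)
    moreover have "A = P + ((t * l) *\<^sub>R id_blinfun - t *\<^sub>R N)"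
      by (simp add: 2(6) f(5) scaleR_diff_right flip: t_def)
    ultimately show ?thesis
      using that[of u "t * l" "t *\<^sub>R N"] 2 kill by (simp add: upper_parts_def)
  qed
qed

lemma splitting_unique:
  assumes "(A, P) \<in> splitting" "(A, P') \<in> splitting"
  shows "P = P'"
  using assms by (elim splittingE) (metis upper_part_unique)

definition upper_part :: "('g \<Rightarrow>\<^sub>L 'g) \<Rightarrow> ('g \<Rightarrow>\<^sub>L 'g)" where
  "upper_part A = (THE P. (A, P) \<in> splitting)"

lemma upper_part_eq: "(A, P) \<in> splitting \<Longrightarrow> upper_part A = P"
  unfolding upper_part_def using splitting_unique by blast

text \<open>By uniqueness the first projection is injective on the compact graph, so its inverse
  \<open>A \<mapsto> (A, upper_part A)\<close> is continuous.\<close>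

lemma continuous_on_upper_part: "continuous_on (fst ` splitting) upper_part"
proof -
  have "continuous_on (fst ` splitting) (\<lambda>A. (A, upper_part A))"
    by (rule continuous_on_inv[OF _ compact_splitting])
      (auto simp: upper_part_eq intro: continuous_intros)
  then show ?thesis
    using continuous_on_snd by fastforce
qed

lemma splitting_pure:
  assumes "u \<in> U" "psd P" "op_trace P = 1" "\<And>x. x \<in> u \<Longrightarrow> P x = 0"
  shows "(P, P) \<in> splitting"
proof -
  have "P o\<^sub>L projL u = 0"
    using assms by (intro blinfun_eqI) (simp add: projL_in subspace_U)
  with assms show ?thesis
    unfolding splitting_def
    by (intro UnI1 image_eqI[where x = "(projL u, P)"]) (auto simp: upper_parts_def)
qed

text \<open>In the application \<open>P\<close> is \<open>(1 - t) p\<close> with \<open>p\<close> of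
  trace 1, so the weight \<open>t\<close> of \<open>q\<close> is recovered as
  \<open>1 - op_trace P\<close>.\<close>

lemma splitting_join:
  assumes "u \<in> U" "psd P" "op_trace P \<le> 1" "\<And>x. x \<in> u \<Longrightarrow> P x = 0"
    and "f # fs \<in> flags I" "f \<subseteq> u" "q \<in> flag_hull (f # fs)"
  shows "(P + (1 - op_trace P) *\<^sub>R q, P) \<in> splitting"
proof -
  have "P o\<^sub>L projL u = 0"
    using assms by (intro blinfun_eqI) (simp add: projL_in subspace_U)
  moreover have "projL u o\<^sub>L projL f = projL f"
    using assms by (simp add: projL_compose_eq_iff subspace_U subspace_I flags_def)
  moreover have "(projL f, q) \<in> hull_pairs DIM('g)"
    using flag_hull_subset_hull_pairs assms by blast
  ultimately show ?thesis
    using assms unfolding splitting_def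
    by (intro UnI2 image_eqI[where x = "(projL u, P, projL f, q)"]) (auto simp: upper_parts_def)
qed

end

section \<open>The deformation\<close>

lemma strong_deformation_retract_segments:
  fixes S :: "'a::real_normed_vector set"
  assumes r: "retraction S T r" and seg: "\<And>x. x \<in> S \<Longrightarrow> closed_segment x (r x) \<subseteq> S"
  shows "strong_deformation_retract T S"
proof -
  have cont: "continuous_on S r" and fixed: "\<And>x. x \<in> T \<Longrightarrow> r x = x"
    using r by (auto simp: retraction_def)
  have "homotopic_with_canon (\<lambda>f. \<forall>a\<in>T. f a = a) S S id r"
    unfolding homotopic_with_def
  proof (intro exI[where x = "\<lambda>(t, x). (1 - t) *\<^sub>R x + t *\<^sub>R r x"] conjI allI ballI)
    have "continuous_on ({0..1} \<times> S) (\<lambda>y. r (snd y))"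
      by (rule continuous_on_compose2[OF cont]) (auto intro!: continuous_intros)
    then have "continuous_on ({0..1} \<times> S) (\<lambda>(t, x). (1 - t) *\<^sub>R x + t *\<^sub>R r x)"
      unfolding case_prod_unfold by (intro continuous_intros)
    moreover have "(1 - t) *\<^sub>R x + t *\<^sub>R r x \<in> S" if "x \<in> S" "0 \<le> t" "t \<le> 1" for t x
      by (rule subsetD[OF seg[OF that(1)]]) (use that(2,3) in \<open>auto simp: in_segment\<close>)
    ultimately show "continuous_map (prod_topology (top_of_set {0..1}) (top_of_set S)) (top_of_set S)
        (\<lambda>(t, x). (1 - t) *\<^sub>R x + t *\<^sub>R r x)"
      by auto
  qed (auto simp: fixed algebra_simps)
  with r show ?thesis
    by (auto simp: strong_deformation_retract_def)
qed

lemma Dset_psd: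
  assumes "A \<in> Dset br AA k"
  shows "psd A" "op_trace A = 1" "x \<in> k \<Longrightarrow> A x = 0" "k \<noteq> UNIV"
  using assms by (auto simp: Dset_def psd_if_spectrum_nonneg split: if_splits)

lemma flagsI_iff:
  "f # fs \<in> flagsI P I \<longleftrightarrow>
    f \<in> P - I \<and> (\<forall>g\<in>set fs. g \<subset> f) \<and> set fs \<subseteq> I \<and> set fs \<subseteq> P \<and> (fs \<noteq> [] \<longrightarrow> fs \<in> flags I)"
  by (auto simp: flagsI_def flags_def)

theorem theorem6p1:
  fixes br :: "'g::euclidean_space \<Rightarrow> 'g \<Rightarrow> 'g"
    and h :: "'g set"
    and AA :: "('g \<Rightarrow>\<^sub>L 'g) set"
    and I :: "'g set set"
    and B :: "'g set \<Rightarrow> ('g \<Rightarrow>\<^sub>L 'g) set"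
  assumes "compact_lie_alg br"
    and "lie_subalg br h" and "h \<noteq> UNIV"
    and "compact_aut_group br h AA"
    and "B = Xset br AA \<or> B = Dset br AA"
    and "admissible (Pset br h AA) I"
  shows "strong_deformation_retract
           (\<Union>f\<in>Pset br h AA - I. B f)
           (butterflies B (flagsI (Pset br h AA) I) - butterflies B (flagsJ (Pset br h AA) I))"
proof -
  define P where "P = Pset br h AA"
  have IP: "I \<subseteq> P" and down: "\<And>l j. l \<in> P \<Longrightarrow> j \<in> I \<Longrightarrow> l \<subseteq> j \<Longrightarrow> l \<in> I" and UNIV_I: "UNIV \<notin> I"
    using assms(6) by (auto simp: admissible_def order_ideal_def P_def)
  have sub: "subspace f" if "f \<in> P" for f
    using that by (simp add: P_def Pset_def lie_subalg_def)
  have UNIV_P: "UNIV \<in> P"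
    using assms(3) by (auto simp: P_def Pset_def lie_subalg_def)
  have "compact (projL ` I)" "compact (projL ` (P - I))"
    using assms(6) by (auto simp: admissible_def compact_semialg_subspaces_def P_def)
  then interpret subspace_ideal I "P - I"
    using IP down UNIV_I UNIV_P sub by unfold_locales auto
  \<comment> \<open>Both versions of \<open>B\<close> are treated together through the properties
    that they inherit from \<open>Dset\<close>.\<close>
  have "B k \<subseteq> Dset br AA k" for k
    using assms(5) by (auto simp: Xset_def)
  then have B: "psd p" "op_trace p = 1" "\<And>x. x \<in> k \<Longrightarrow> p x = 0" "k \<noteq> UNIV" if "p \<in> B k" for p k
    using that Dset_psd by blast+

  define J where "J = butterflies B (flagsJ P I)"
  define S where "S = butterflies B (flagsI P I) - J"
  define T where "T = (\<Union>f\<in>P - I. B f)"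
  \<comment> \<open>Dividing by the trace recovers \<open>p\<close> from \<open>(1 - t) p\<close>;
    on \<open>S\<close> this trace is nonzero.\<close>
  define r where "r A = (1 / op_trace (upper_part A)) *\<^sub>R upper_part A" for A

  \<comment> \<open>Every simplex over the ideal is removed, because \<open>UNIV\<close> can be put
    on top of its flag.\<close>
  have J_hull: "q \<in> J" if q: "fs \<in> flags I" "q \<in> flag_hull fs" for q fs
  proof -
    have "UNIV # fs \<in> flagsJ P I"
      using q IP UNIV_I UNIV_P by (auto simp: flagsJ_def flagsI_iff flags_def)
    moreover have "butterfly B (UNIV # fs) = flag_hull fs"
      using q by (simp add: flags_def butterfly_def)
    ultimately show ?thesis
      unfolding J_def butterflies_def using q(2) by blast
  qed
  \<comment> \<open>Conversely, since \<open>B UNIV\<close> is empty, a point of \<open>J\<close>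
    lies in a simplex over the ideal. It then splits with upper part 0, which separates
    \<open>J\<close> from the points with \<open>t < 1\<close>.\<close>
  have J_upper: "upper_part A = 0" if A: "A \<in> J" for A
  proof -
    obtain \<phi> where \<phi>: "\<phi> \<in> flagsJ P I" "A \<in> butterfly B \<phi>"
      using A by (auto simp: J_def butterflies_def)
    moreover obtain f fs where "\<phi> = f # fs"
      using \<phi>(1) by (cases \<phi>) (auto simp: flagsJ_def flagsI_def flags_def)
    ultimately have "f # fs \<in> flagsI P I" "f = UNIV" "A \<in> butterfly B (UNIV # fs)"
      using UNIV_I by (auto simp: flagsJ_def flagsI_iff)
    moreover from this have "fs \<noteq> []"
      using B(4)[of A UNIV] by (auto simp: butterfly_def)
    ultimately obtain g gs where g: "g # gs \<in> flags I" "A \<in> flag_hull (g # gs)"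
      by (cases fs) (auto simp: butterfly_def flagsI_iff)
    have "(0 + (1 - op_trace (0 :: 'g \<Rightarrow>\<^sub>L 'g)) *\<^sub>R A, 0) \<in> splitting"
      by (rule splitting_join[OF UNIV_in_U _ _ _ g(1) _ g(2)]) auto
    then show ?thesis
      by (simp add: upper_part_eq)
  qed

  have pure: "(p, p) \<in> splitting" "p \<in> S" if "f \<in> P - I" "p \<in> B f" for p f
  proof -
    show split: "(p, p) \<in> splitting"
      by (rule splitting_pure[OF that(1)]) (use B[OF that(2)] in auto)
    have "p \<notin> J"
      using J_upper[of p] upper_part_eq[OF split] B(2)[OF that(2)] by auto
    moreover have "p \<in> butterfly B [f]" "[f] \<in> flagsI P I"
      using that by (auto simp: butterfly_def flagsI_iff)
    ultimately show "p \<in> S"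
      unfolding S_def butterflies_def by blast
  qed
  have join: "((1 - t) *\<^sub>R p + t *\<^sub>R q, (1 - t) *\<^sub>R p) \<in> splitting"
      "t < 1 \<longrightarrow> (1 - t) *\<^sub>R p + t *\<^sub>R q \<in> S"
    if "f # fs \<in> flagsI P I" "fs \<noteq> []" "p \<in> B f" "q \<in> flag_hull fs" "0 \<le> t" "t \<le> 1" for t p q f fs
  proof -
    obtain g gs where fs: "fs = g # gs"
      using \<open>fs \<noteq> []\<close> by (cases fs) auto
    have "((1 - t) *\<^sub>R p + (1 - op_trace ((1 - t) *\<^sub>R p)) *\<^sub>R q, (1 - t) *\<^sub>R p) \<in> splitting"
    proof (rule splitting_join)
      show "f \<in> P - I" "g # gs \<in> flags I" "g \<subseteq> f" "q \<in> flag_hull (g # gs)"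
        using that by (auto simp: flagsI_iff fs)
      show "psd ((1 - t) *\<^sub>R p)" "op_trace ((1 - t) *\<^sub>R p) \<le> 1"
        using B[OF that(3)] that(5,6) by (simp_all add: psd_scaleR)
      show "((1 - t) *\<^sub>R p) x = 0" if "x \<in> f" for x
        using B(3)[OF \<open>p \<in> B f\<close> that] by (simp add: blinfun.bilinear_simps)
    qed
    then show split: "((1 - t) *\<^sub>R p + t *\<^sub>R q, (1 - t) *\<^sub>R p) \<in> splitting"
      by (simp add: B(2)[OF that(3)])
    have "(1 - t) *\<^sub>R p + t *\<^sub>R q \<notin> J" if "t < 1"
    proof
      assume "(1 - t) *\<^sub>R p + t *\<^sub>R q \<in> J"
      then have "(1 - t) *\<^sub>R p = 0"
        using J_upper upper_part_eq[OF split] by metis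
      with that have "p = 0" by simp
      with B(2)[OF \<open>p \<in> B f\<close>] show False by simp
    qed
    moreover have "(1 - t) *\<^sub>R p + t *\<^sub>R q \<in> closed_segment p q"
      using that(5,6) by (auto simp: in_segment)
    then have "(1 - t) *\<^sub>R p + t *\<^sub>R q \<in> butterfly B (f # fs)"
      using that(2-4) B(4)[OF that(3)] by (auto simp: butterfly_def)
    ultimately show "t < 1 \<longrightarrow> (1 - t) *\<^sub>R p + t *\<^sub>R q \<in> S"
      using that(1) unfolding S_def butterflies_def by blast
  qed
  have S_cases: "(\<exists>f\<in>P - I. A \<in> B f) \<or> (\<exists>f fs p q t. f # fs \<in> flagsI P I \<and> fs \<noteq> [] \<and> p \<in> B f \<and>
      q \<in> flag_hull fs \<and> 0 \<le> t \<and> t < 1 \<and> A = (1 - t) *\<^sub>R p + t *\<^sub>R q)" if A: "A \<in> S" for A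
  proof -
    obtain \<phi> where \<phi>: "\<phi> \<in> flagsI P I" "A \<in> butterfly B \<phi>"
      using A by (auto simp: S_def butterflies_def)
    moreover obtain f fs where "\<phi> = f # fs"
      using \<phi>(1) by (cases \<phi>) (auto simp: flagsI_def flags_def)
    ultimately have f: "f # fs \<in> flagsI P I" "A \<in> butterfly B (f # fs)"
      by auto
    show ?thesis
    proof (cases "fs = []")
      case True
      then show ?thesis
        using f by (auto simp: butterfly_def flagsI_iff)
    next
      case False
      then have fl: "fs \<in> flags I"
        using f(1) by (simp add: flagsI_iff)
      \<comment> \<open>Avoiding the simplex excludes both the branch \<open>f = UNIV\<close> of
        \<open>butterfly\<close> and the endpoint \<open>t = 1\<close>.\<close>
      have notJ: "A \<notin> flag_hull fs"
        using J_hull[OF fl, of A] A by (auto simp: S_def)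
      then obtain p q where pq: "p \<in> B f" "q \<in> flag_hull fs" "A \<in> closed_segment p q"
        using f(2) False by (auto simp: butterfly_def split: if_splits)
      then obtain t where t: "0 \<le> t" "t \<le> 1" "A = (1 - t) *\<^sub>R p + t *\<^sub>R q"
        by (auto simp: in_segment)
      with notJ pq(2) have "t \<noteq> 1"
        by auto
      with t pq f(1) False show ?thesis
        by (metis order_le_imp_less_or_eq)
    qed
  qed

  have r_pure: "r p = p" if "f \<in> P - I" "p \<in> B f" for f p
    using upper_part_eq[OF pure(1)[OF that]] B(2)[OF that(2)] by (simp add: r_def)
  have r_join: "r ((1 - t) *\<^sub>R p + t *\<^sub>R q) = p"
    if "f # fs \<in> flagsI P I" "fs \<noteq> []" "p \<in> B f" "q \<in> flag_hull fs" "0 \<le> t" "t < 1" for t p q f fs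
    using upper_part_eq[OF join(1)[OF that(1-5)]] that(6) B(2)[OF that(3)] by (simp add: r_def)

  have S_split: "A \<in> fst ` splitting \<and> op_trace (upper_part A) \<noteq> 0" if "A \<in> S" for A
    using S_cases[OF that]
  proof (elim disjE bexE exE conjE)
    fix f assume "f \<in> P - I" "A \<in> B f"
    then have "(A, A) \<in> splitting" "op_trace A = 1"
      using pure(1) B(2) by blast+
    then show ?thesis
      using upper_part_eq by force
  next
    fix f fs p q t
    assume *: "f # fs \<in> flagsI P I" "fs \<noteq> []" "p \<in> B f" "q \<in> flag_hull fs" "0 \<le> t" "t < 1"
      and A: "A = (1 - t) *\<^sub>R p + t *\<^sub>R q"
    have "(A, (1 - t) *\<^sub>R p) \<in> splitting"
      unfolding A using join(1)[OF *(1-5)] *(6) by simp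
    moreover have "op_trace ((1 - t) *\<^sub>R p) \<noteq> 0"
      using B(2)[OF *(3)] *(6) by simp
    ultimately show ?thesis
      using upper_part_eq by force
  qed
  have "continuous_on S upper_part"
    by (rule continuous_on_subset[OF continuous_on_upper_part]) (use S_split in blast)
  then have cont: "continuous_on S r"
    unfolding r_def by (intro continuous_intros) (use S_split in auto)

  have "retraction S T r"
    unfolding retraction_def
  proof (intro conjI funcsetI ballI)
    show "T \<subseteq> S"
      using pure(2) by (auto simp: T_def)
    show "r x = x" if "x \<in> T" for x
      using that r_pure by (auto simp: T_def)
    show "r A \<in> T" if "A \<in> S" for A
      using S_cases[OF that]
    proof (elim disjE bexE exE conjE)
      fix f assume "f \<in> P - I" "A \<in> B f"
      then show ?thesis
        using r_pure[of f A] by (auto simp: T_def)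
    next
      fix f fs p q t
      assume *: "f # fs \<in> flagsI P I" "fs \<noteq> []" "p \<in> B f" "q \<in> flag_hull fs" "0 \<le> t" "t < 1"
        and A: "A = (1 - t) *\<^sub>R p + t *\<^sub>R q"
      then show ?thesis
        using r_join[OF *] by (auto simp: T_def flagsI_iff)
    qed
  qed fact
  moreover have "closed_segment A (r A) \<subseteq> S" if "A \<in> S" for A
    using S_cases[OF that]
  proof (elim disjE bexE exE conjE)
    fix f assume "f \<in> P - I" "A \<in> B f"
    then show ?thesis
      using r_pure[of f A] that by simp
  next
    fix f fs p q t
    assume *: "f # fs \<in> flagsI P I" "fs \<noteq> []" "p \<in> B f" "q \<in> flag_hull fs" "0 \<le> t" "t < 1"
      and A: "A = (1 - t) *\<^sub>R p + t *\<^sub>R q"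
    show ?thesis
    proof
      fix C assume "C \<in> closed_segment A (r A)"
      then obtain s where s: "0 \<le> s" "s \<le> 1" "C = (1 - s) *\<^sub>R A + s *\<^sub>R p"
        using r_join[OF *] by (auto simp: in_segment A)
      \<comment> \<open>Moving towards \<open>p\<close> keeps \<open>p\<close> and \<open>q\<close>
        and shrinks the weight of \<open>q\<close> by the factor \<open>1 - s\<close>, so it stays
        below 1.\<close>
      define t' where "t' = (1 - s) * t"
      have "t' \<le> 1 * t"
        unfolding t'_def using s *(5) by (intro mult_right_mono) auto
      then have t': "0 \<le> t'" "t' < 1"
        using s *(5,6) by (auto simp: t'_def)
      have "C = (1 - t') *\<^sub>R p + t' *\<^sub>R q"
        by (simp add: s(3) A t'_def algebra_simps)
      then show "C \<in> S"
        using join(2)[OF *(1-4) t'(1)] t'(2) by simp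
    qed
  qed
  ultimately show ?thesis
    unfolding S_def J_def T_def P_def by (rule strong_deformation_retract_segments)
qed

end
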